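(* Let $t\ge 2$ and let $r,s$ be fixed positive integers with $s\le r$. Then, as $m\to\infty$, $$\mathrm{forb}(m,\{Q_3(t),\,I_r\times I_s^c\})=O(m^{2-1/s}).$$
   Context: A matrix is simple if it is a $(0,1)$-matrix with no repeated columns. $F\prec A$ means that some submatrix of $A$ is a row and column permutation of $F$. For a family $\mathcal F$ of $(0,1)$-matrices, $\mathrm{forb}(m,\mathcal F)$ is the maximum number of columns of an $m$-rowed simple matrix $A$ with $F\nprec A$ for all $F\in\mathcal F$. $I_k$ is the $k\times k$ identity matrix and $I_k^c$ its $(0,1)$-complement. For an $m_1\times n_1$ matrix $A$ and an $m_2\times n_2$ matrix $B$, $A\times B$ is the $(m_1+m_2)\times n_1n_2$ matrix whose columns are all combinations obtained by placing a column of $A$ on top of a column of $B$. For $t\ge 2$, $Q_3(t)$ is the $2\times(2t+2)$ matrix whose columns are: $\begin{bmatrix}0\\0\end{bmatrix}$ once, $\begin{bmatrix}1\\0\end{bmatrix}$ exactly $t$ times, $\begin{bmatrix}0\\1\end{bmatrix}$ exactly $t$ times, and $\begin{bmatrix}1\\1\end{bmatrix}$ once. The implied constant may depend on $r,s,t$. *)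

theory Defs
  imports
    "Jordan_Normal_Form.Matrix"
    "Jordan_Normal_Form.DL_Submatrix"
    "HOL-Combinatorics.Permutations"
    "HOL-Library.Landau_Symbols"
begin

definition zero_one_mat :: "nat mat \<Rightarrow> bool" where
  "zero_one_mat A \<longleftrightarrow> elements_mat A \<subseteq> {0, 1}"

definition simple_mat :: "nat mat \<Rightarrow> bool" where
  "simple_mat A \<longleftrightarrow> zero_one_mat A \<and> distinct (cols A)"

definition row_col_permutation :: "'a mat \<Rightarrow> 'a mat \<Rightarrow> bool" where
  "row_col_permutation F B \<longleftrightarrow>
     (\<exists>p q. p permutes {..<dim_row F} \<and> q permutes {..<dim_col F} \<and>
        B = mat (dim_row F) (dim_col F) (\<lambda>(i, j). F $$ (p i, q j)))"

definition configuration_of :: "'a mat \<Rightarrow> 'a mat \<Rightarrow> bool" (infix "\<prec>" 50) where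
  "F \<prec> A \<longleftrightarrow>
     (\<exists>I J. I \<subseteq> {..<dim_row A} \<and> J \<subseteq> {..<dim_col A} \<and> row_col_permutation F (submatrix A I J))"

definition avoiding_mats :: "nat \<Rightarrow> nat mat set \<Rightarrow> nat mat set" where
  "avoiding_mats m \<F> = {A. dim_row A = m \<and> simple_mat A \<and> (\<forall>F\<in>\<F>. \<not> F \<prec> A)}"

text \<open>The maximum is taken over a finite set; the set is nonempty, and the maximum therefore
  meaningful, as soon as every member of the family has at least one column
  (both facts are proved below).\<close>

definition forb :: "nat \<Rightarrow> nat mat set \<Rightarrow> nat" where
  "forb m \<F> = Max (dim_col ` avoiding_mats m \<F>)"

definition complement_mat :: "nat mat \<Rightarrow> nat mat" where
  "complement_mat A = map_mat (\<lambda>x. 1 - x) A"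

text \<open>Column \<open>j\<close> of the product is column \<open>j div dim_col B\<close> of \<open>A\<close> on top of column
  \<open>j mod dim_col B\<close> of \<open>B\<close>, so that every pair of columns occurs exactly once.\<close>

definition mat_product :: "'a mat \<Rightarrow> 'a mat \<Rightarrow> 'a mat" where
  "mat_product A B = mat (dim_row A + dim_row B) (dim_col A * dim_col B)
     (\<lambda>(i, j). if i < dim_row A then A $$ (i, j div dim_col B)
               else B $$ (i - dim_row A, j mod dim_col B))"

definition Q3 :: "nat \<Rightarrow> nat mat" where
  "Q3 t = mat_of_cols_list 2
     ([[0, 0]] @ replicate t [1, 0] @ replicate t [0, 1] @ [[1, 1]])"

lemma finite_dim_col_avoiding: "finite (dim_col ` avoiding_mats m \<F>)"
proof (rule finite_surj)
  let ?S = "vec_of_list ` {xs :: nat list. set xs \<subseteq> {0, 1} \<and> length xs = m}"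
  have fin: "finite ?S"
    by (intro finite_imageI finite_lists_length_eq) simp
  show "finite {..card ?S}" by simp
  show "dim_col ` avoiding_mats m \<F> \<subseteq> id ` {..card ?S}"
  proof
    fix n assume "n \<in> dim_col ` avoiding_mats m \<F>"
    then obtain A where A: "A \<in> avoiding_mats m \<F>" and n: "n = dim_col A" by blast
    have "set (cols A) \<subseteq> ?S"
    proof
      fix v assume "v \<in> set (cols A)"
      then obtain j where j: "j < dim_col A" "v = col A j"
        by (auto simp: cols_def)
      have dim: "dim_row A = m" and el: "elements_mat A \<subseteq> {0, 1}"
        using A by (auto simp: avoiding_mats_def simple_mat_def zero_one_mat_def)
      have "A $$ (i, j) \<in> {0, 1}" if "i < m" for i
        using elements_matI[of A m "dim_col A" i j "A $$ (i, j)"] that dim j(1) el by blast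
      then have "set (list_of_vec v) \<subseteq> {0, 1}"
        using j dim by (fastforce simp: set_list_of_vec vec_set_def)
      moreover have "length (list_of_vec v) = m"
        using j dim by simp
      ultimately show "v \<in> ?S"
        by (intro image_eqI[of _ _ "list_of_vec v"]) (auto simp: vec_list)
    qed
    moreover have "card (set (cols A)) = dim_col A"
      using A by (simp add: avoiding_mats_def simple_mat_def distinct_card)
    ultimately have "dim_col A \<le> card ?S"
      by (metis card_mono fin)
    then show "n \<in> id ` {..card ?S}"
      unfolding n image_id id_apply by (rule atMost_iff[THEN iffD2])
  qed
qed

lemma avoiding_mats_nonempty:
  assumes "\<And>F. F \<in> \<F> \<Longrightarrow> dim_col F > 0"
  shows "avoiding_mats m \<F> \<noteq> {}"
proof -
  have "\<not> F \<prec> 0\<^sub>m m 0" if "F \<in> \<F>" for F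
    using assms[OF that]
    by (auto simp: configuration_of_def row_col_permutation_def dest!: arg_cong[where f = dim_col]
        simp: dim_submatrix)
  then have "0\<^sub>m m 0 \<in> avoiding_mats m \<F>"
    by (simp add: avoiding_mats_def simple_mat_def zero_one_mat_def elements_mat_def cols_def)
  then show ?thesis by blast
qed

end

theory Submission
  imports Defs
begin

text \<open>
  Read columns as sets of rows. Avoiding \<open>Q3 t\<close> means that any two rows \<open>x\<close>, \<open>y\<close> have no common zero,
  or no common one, or one of the two patterns "\<open>x\<close> but not \<open>y\<close>", "\<open>y\<close> but not \<open>x\<close>" occurs
  fewer than \<open>t\<close> times. Call a column defective if it shows such a rare pattern. The non-defective
  columns shatter no pair of rows, so there are at most \<open>m + 1\<close> of them.

  Assign to every defective column one rare pair \<open>(x, y)\<close> that it shows; at most \<open>t\<close> columns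
  share a pair, so the number of defective columns is governed by the digraph \<open>E\<close> of used pairs.
  Fix a column \<open>\<alpha> (x, y)\<close> for each edge; these are distinct. As "\<open>x\<close> but not \<open>y\<close>" is
  rare, \<open>y \<notin> \<alpha> (x, y')\<close> for at most \<open>t\<close> vertices \<open>y'\<close>, so each out-neighbourhood can be thinned by a
  constant factor until \<open>\<alpha> (x, y')\<close> contains all its other members. If more than
  \<open>O(m powr (2 - 1 / s))\<close> edges survive, the Kovari-Sos-Turan argument gives an \<open>s\<close>-set \<open>S\<close> of common
  out-neighbours of many vertices \<open>x\<close>. Thinning these in the same way until no \<open>\<alpha> (x, y)\<close> with
  \<open>y \<in> S\<close> contains another of them leaves \<open>r\<close> rows which, with \<open>S\<close>, carry
  \<open>I_r \<times> I_s^c\<close>. Only the thinning on the \<open>x\<close> side may be postponed until after that argument,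
  because \<open>s\<close> must not grow.
\<close>

section \<open>Extremal tools: shattering, independent sets, dense digraphs\<close>

text \<open>This is the Sauer-Shelah bound for VC dimension at most 1. Deleting a point
  \<open>x\<close> leaves the traces \<open>G \<union> H\<close>, bounded by induction. The loss
  \<open>G \<inter> H\<close> consists of the traces that extend both with and without
  \<open>x\<close>.\<close>

lemma card_le_Suc_if_no_pair_shattered:
  assumes "finite X" and "F \<subseteq> Pow X"
    and "\<forall>x\<in>X. \<forall>y\<in>X. x \<noteq> y \<longrightarrow> (\<exists>p q. \<forall>A\<in>F. \<not> ((x \<in> A) = p \<and> (y \<in> A) = q))"
  shows "card F \<le> Suc (card X)"
  using assms
proof (induction X arbitrary: F rule: finite_induct)
  case empty
  then have "F \<subseteq> {{}}" by auto
  then have "card F \<le> card {{} :: 'a set}" by (intro card_mono) auto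
  then show ?case by simp
next
  case (insert x X)
  define G where "G = {A \<in> F. x \<notin> A}"
  define H where "H = (\<lambda>A. A - {x}) ` {A \<in> F. x \<in> A}"
  have finF: "finite F"
    using insert.prems(1) insert.hyps(1) by (meson finite.insertI finite_Pow_iff finite_subset)
  have fin: "finite G" "finite H"
    using finF by (auto simp: G_def H_def)
  have "F = G \<union> {A \<in> F. x \<in> A}" by (auto simp: G_def)
  then have "card F = card G + card {A \<in> F. x \<in> A}"
    using finF by (subst card_Un_disjoint[symmetric]) (auto simp: G_def)
  also have "card {A \<in> F. x \<in> A} = card H"
    unfolding H_def by (subst card_image) (auto simp: inj_on_def)
  also have "card G + card H = card (G \<union> H) + card (G \<inter> H)"
    using fin by (rule card_Un_Int)
  also have "card (G \<union> H) \<le> Suc (card X)"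
  proof (rule insert.IH)
    show "G \<union> H \<subseteq> Pow X" using insert.prems(1) by (auto simp: G_def H_def)
    show "\<forall>u\<in>X. \<forall>v\<in>X. u \<noteq> v \<longrightarrow>
        (\<exists>p q. \<forall>A\<in>G \<union> H. \<not> ((u \<in> A) = p \<and> (v \<in> A) = q))"
    proof (intro ballI impI)
      fix u v assume uv: "u \<in> X" "v \<in> X" "u \<noteq> v"
      then obtain p q where "\<forall>A\<in>F. \<not> ((u \<in> A) = p \<and> (v \<in> A) = q)"
        using insert.prems(2) by blast
      moreover have "u \<noteq> x" "v \<noteq> x" using uv insert.hyps(2) by auto
      ultimately have "\<forall>A\<in>G \<union> H. \<not> ((u \<in> A) = p \<and> (v \<in> A) = q)"
        by (auto simp: G_def H_def)
      then show "\<exists>p q. \<forall>A\<in>G \<union> H. \<not> ((u \<in> A) = p \<and> (v \<in> A) = q)" by blast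
    qed
  qed
  also have "card (G \<inter> H) \<le> Suc 0"
  proof (rule card_le_Suc0_iff_eq[THEN iffD2])
    show "finite (G \<inter> H)" using fin by blast
    \<comment> \<open>Two different members of \<open>G \<inter> H\<close> differ at some
      \<open>y\<close>; together with their extensions by \<open>x\<close> they would show all four
      patterns on \<open>x\<close>, \<open>y\<close>.\<close>
    show "\<forall>A\<in>G \<inter> H. \<forall>B\<in>G \<inter> H. A = B"
    proof (intro ballI, rule ccontr)
      fix A B assume AB: "A \<in> G \<inter> H" "B \<in> G \<inter> H" and "A \<noteq> B"
      then obtain y where y: "(y \<in> A) = (y \<notin> B)" by blast
      have mem: "A \<in> F" "B \<in> F" "insert x A \<in> F" "insert x B \<in> F" "x \<notin> A" "x \<notin> B"
        using AB by (auto simp: G_def H_def insert_absorb)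
      then have "y \<in> X" "y \<noteq> x" using y insert.prems(1) by blast+
      then obtain p q where "\<forall>C\<in>F. \<not> ((x \<in> C) = p \<and> (y \<in> C) = q)"
        using insert.prems(2) by (metis insertI1 insertI2)
      then show False using mem y \<open>y \<noteq> x\<close> by (metis insert_iff)
    qed
  qed
  finally show ?case using insert.hyps by simp
qed

lemma sum_card_filter_swap:
  assumes "finite A" "finite B"
  shows "(\<Sum>a\<in>A. card {b \<in> B. P a b}) = (\<Sum>b\<in>B. card {a \<in> A. P a b})"
  using sum.swap_restrict[OF assms, of "\<lambda>_ _. 1 :: nat" P] by simp

text \<open>Read \<open>Q u v\<close> as an arc from \<open>u\<close> to \<open>v\<close>, so that
  in-degrees are at most \<open>d\<close>. In-degrees and out-degrees have the same sum, so some
  vertex has out-degree at most \<open>d\<close> as well. Taking it greedily and deleting it with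
  all its neighbours costs at most \<open>2 * d + 1\<close> vertices per chosen one.\<close>

lemma exists_large_independent_set:
  assumes "finite V" and "\<forall>v\<in>V. card {u \<in> V. Q u v} \<le> d"
  shows "\<exists>W\<subseteq>V. (\<forall>u\<in>W. \<forall>v\<in>W. u \<noteq> v \<longrightarrow> \<not> Q u v) \<and> card V \<le> (2 * d + 1) * card W"
  using assms
proof (induction V rule: finite_psubset_induct)
  case (psubset V)
  show ?case
  proof (cases "V = {}")
    case False
    have "\<exists>v\<in>V. card {u \<in> V. Q v u} \<le> d"
    proof (rule ccontr)
      assume "\<not> ?thesis"
      then have "(\<Sum>v\<in>V. d) < (\<Sum>v\<in>V. card {u \<in> V. Q v u})"
        using False psubset.hyps(1) by (intro sum_strict_mono) auto
      also have "\<dots> = (\<Sum>v\<in>V. card {u \<in> V. Q u v})"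
        using psubset.hyps(1) by (intro sum_card_filter_swap)
      also have "\<dots> \<le> (\<Sum>v\<in>V. d)"
        using psubset.prems by (intro sum_mono) auto
      finally show False by simp
    qed
    then obtain v where v: "v \<in> V" "card {u \<in> V. Q v u} \<le> d" by blast
    define Z where "Z = insert v ({u \<in> V. Q v u} \<union> {u \<in> V. Q u v})"
    have Z: "Z \<subseteq> V" "finite Z" using v psubset.hyps(1) by (auto simp: Z_def)
    have "card Z \<le> Suc (card ({u \<in> V. Q v u} \<union> {u \<in> V. Q u v}))"
      unfolding Z_def by (rule card_insert_le_m1) auto
    also have "card ({u \<in> V. Q v u} \<union> {u \<in> V. Q u v}) \<le> d + d"
      using v psubset.prems by (meson add_mono card_Un_le order_trans)
    finally have cZ: "card Z \<le> 2 * d + 1" by simp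
    have "V - Z \<subset> V" using v by (auto simp: Z_def)
    moreover have "\<forall>w\<in>V - Z. card {u \<in> V - Z. Q u w} \<le> d"
    proof
      fix w assume "w \<in> V - Z"
      then have "card {u \<in> V. Q u w} \<le> d" using psubset.prems by blast
      moreover have "card {u \<in> V - Z. Q u w} \<le> card {u \<in> V. Q u w}"
        using psubset.hyps(1) by (intro card_mono) auto
      ultimately show "card {u \<in> V - Z. Q u w} \<le> d" by simp
    qed
    ultimately obtain W where W: "W \<subseteq> V - Z" "\<forall>u\<in>W. \<forall>v\<in>W. u \<noteq> v \<longrightarrow> \<not> Q u v"
        "card (V - Z) \<le> (2 * d + 1) * card W"
      using psubset.IH by meson
    have "finite W" "v \<notin> W"
      using W(1) psubset.hyps(1) by (auto simp: Z_def intro: finite_subset)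
    moreover have "card V = card (V - Z) + card Z"
      using Z psubset.hyps(1) by (metis card_Diff_subset card_mono le_add_diff_inverse2)
    ultimately have "card V \<le> (2 * d + 1) * card (insert v W)"
      using W(3) cZ by simp
    moreover have "\<forall>a\<in>insert v W. \<forall>b\<in>insert v W. a \<noteq> b \<longrightarrow> \<not> Q a b"
      using W(1,2) by (auto simp: Z_def)
    moreover have "insert v W \<subseteq> V" using W(1) v by auto
    ultimately show ?thesis by blast
  qed auto
qed

text \<open>Double counting of pairs of a vertex \<open>x\<close> and an \<open>s\<close>-subset of
  \<open>N x\<close>: \<open>few\<close> bounds their number from above, while vertices of large
  degree contribute many.\<close>

lemma kovari_sos_turan:
  fixes N :: "'a \<Rightarrow> 'a set"
  assumes X: "finite X" "X \<noteq> {}" and s: "s \<ge> 1"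
    and N: "\<forall>x\<in>X. N x \<subseteq> X"
    and few: "\<forall>S\<subseteq>X. card S = s \<longrightarrow> card {x \<in> X. S \<subseteq> N x} \<le> R"
  shows "(\<Sum>x\<in>X. real (card (N x)))
    \<le> (1 + real s + real s ^ s * real R) * real (card X) powr (2 - 1 / real s)"
proof -
  define m where "m = real (card X)"
  \<comment> \<open>This threshold balances the two contributions: \<open>m * L\<close> and
    \<open>m ^ s / L ^ (s - 1)\<close> both equal \<open>m powr (2 - 1 / real s)\<close>.\<close>
  define L where "L = m powr (1 - 1 / real s)"
  have m: "m \<ge> 1" using X by (simp add: m_def Suc_le_eq card_gt_0_iff)
  have L: "L \<ge> 1" using m s by (auto simp: L_def intro!: ge_one_powr_ge_zero)
  have finN: "finite (N x)" if "x \<in> X" for x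
    using N X(1) that finite_subset by blast
  \<comment> \<open>A threshold at \<open>L\<close> in place of the power mean inequality.\<close>
  have deg: "real d \<le> L + real s + real s ^ s * real (d choose s) / L ^ (s - 1)" for d
  proof (cases "real d \<le> L + real s")
    case True
    moreover have "0 \<le> real s ^ s * real (d choose s) / L ^ (s - 1)" using L by simp
    ultimately show ?thesis by linarith
  next
    case False
    have "L ^ (s - 1) * real d \<le> real d ^ (s - 1) * real d"
      using False L by (intro mult_right_mono power_mono) auto
    also have "\<dots> = real d ^ s" using s by (simp add: power_eq_if mult.commute)
    also have "\<dots> = real s ^ s * (real d / real s) ^ s"
      using s by (simp add: power_divide)
    \<comment> \<open>This bound on the binomial coefficient requires \<open>s \<le> d\<close>,
      which is why the threshold is \<open>L + real s\<close> and not \<open>L\<close>.\<close>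
    also have "\<dots> \<le> real s ^ s * real (d choose s)"
      using False L by (intro mult_left_mono binomial_ge_n_over_k_pow_k) auto
    finally have "real d \<le> real s ^ s * real (d choose s) / L ^ (s - 1)"
      using L by (simp add: field_simps)
    then show ?thesis using L by simp
  qed
  let ?\<S> = "{S. S \<subseteq> X \<and> card S = s}"
  have "(\<Sum>x\<in>X. card (N x) choose s) = (\<Sum>x\<in>X. card {S \<in> ?\<S>. S \<subseteq> N x})"
  proof (rule sum.cong[OF refl])
    fix x assume x: "x \<in> X"
    have "{S \<in> ?\<S>. S \<subseteq> N x} = {S. S \<subseteq> N x \<and> card S = s}" using N x by auto
    then show "(card (N x) choose s) = card {S \<in> ?\<S>. S \<subseteq> N x}"
      using n_subsets[OF finN[OF x]] by simp
  qed
  also have "\<dots> = (\<Sum>S\<in>?\<S>. card {x \<in> X. S \<subseteq> N x})"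
    using X by (intro sum_card_filter_swap) auto
  also have "\<dots> \<le> (\<Sum>S\<in>?\<S>. R)" using few by (intro sum_mono) auto
  also have "\<dots> = (card X choose s) * R" using n_subsets[OF X(1)] by simp
  also have "\<dots> \<le> card X ^ s * R"
    by (cases "s \<le> card X") (auto simp: binomial_eq_0 binomial_le_pow)
  finally have "real (\<Sum>x\<in>X. card (N x) choose s) \<le> real (card X ^ s * R)"
    by (rule of_nat_mono)
  then have cnt: "(\<Sum>x\<in>X. real (card (N x) choose s)) \<le> m ^ s * real R"
    by (simp add: m_def)
  have "(\<Sum>x\<in>X. real (card (N x)))
      \<le> (\<Sum>x\<in>X. L + real s + real s ^ s / L ^ (s - 1) * real (card (N x) choose s))"
    using deg by (intro sum_mono) simp
  also have "\<dots> = m * (L + real s)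
      + real s ^ s / L ^ (s - 1) * (\<Sum>x\<in>X. real (card (N x) choose s))"
    by (simp add: sum.distrib sum_distrib_left sum_divide_distrib m_def algebra_simps)
  also have "\<dots> \<le> m * (L + real s) + real s ^ s / L ^ (s - 1) * (m ^ s * real R)"
    using cnt L by (intro add_left_mono mult_left_mono) auto
  also have "m ^ s = m powr (2 - 1 / real s) * L ^ (s - 1)"
  proof -
    have "L ^ (s - 1) = m powr ((1 - 1 / real s) * real (s - 1))"
      using m by (simp add: L_def powr_powr flip: powr_realpow)
    then have "m powr (2 - 1 / real s) * L ^ (s - 1)
        = m powr (2 - 1 / real s + (1 - 1 / real s) * real (s - 1))"
      by (simp add: powr_add)
    also have "2 - 1 / real s + (1 - 1 / real s) * real (s - 1) = real s"
      using s by (simp add: field_simps of_nat_diff)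
    finally show ?thesis using m by (simp add: powr_realpow)
  qed
  also have "real s ^ s / L ^ (s - 1) * (m powr (2 - 1 / real s) * L ^ (s - 1) * real R)
      = real s ^ s * real R * m powr (2 - 1 / real s)"
    using L by simp
  also have "m * (L + real s) \<le> (1 + real s) * (m * L)"
    using L m s by (simp add: algebra_simps)
  also have "m * L = m powr (2 - 1 / real s)"
  proof -
    have "m * L = m powr (1 + (1 - 1 / real s))"
      unfolding powr_add using m by (simp add: L_def)
    also have "1 + (1 - 1 / real s) = 2 - 1 / real s" by simp
    finally show ?thesis .
  qed
  finally show ?thesis by (simp add: m_def algebra_simps)
qed

section \<open>The bound for set families\<close>

text \<open>In the constant, \<open>2\<close> pays for the non-defective sets, \<open>t\<close> for
  the sets sharing a pair, and \<open>2 * t + 1\<close> for thinning the out-neighbourhoods. The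
  last factor comes from \<open>kovari_sos_turan\<close> with
  \<open>R = (2 * (s * t) + 1) * r + s\<close>.\<close>

lemma real_card_family_le:
  fixes F :: "'a set set"
  assumes X: "finite X" "X \<noteq> {}" and s: "s \<ge> 1" and F: "F \<subseteq> Pow X"
    and pairs: "\<forall>x\<in>X. \<forall>y\<in>X. x \<noteq> y \<longrightarrow>
      (\<forall>A\<in>F. x \<in> A \<or> y \<in> A) \<or> (\<forall>A\<in>F. \<not> (x \<in> A \<and> y \<in> A)) \<or>
      card {A \<in> F. x \<in> A \<and> y \<notin> A} < t \<or> card {A \<in> F. y \<in> A \<and> x \<notin> A} < t"
    and no_product: "\<not> (\<exists>W\<subseteq>X. \<exists>S\<subseteq>X. W \<inter> S = {} \<and> card W = r \<and> card S = s \<and>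
      (\<forall>x\<in>W. \<forall>y\<in>S. \<exists>A\<in>F. A \<inter> W = {x} \<and> A \<inter> S = S - {y}))"
  shows "real (card F) \<le>
    (2 + real (t * (2 * t + 1)) * (1 + real s + real s ^ s * real ((2 * (s * t) + 1) * r + s)))
      * real (card X) powr (2 - 1 / real s)"
proof -
  let ?B = "real (card X) powr (2 - 1 / real s)"
  define P where "P x y \<longleftrightarrow> x \<in> X \<and> y \<in> X \<and> x \<noteq> y \<and> card {A \<in> F. x \<in> A \<and> y \<notin> A} < t" for x y
  define D where "D = {A \<in> F. \<exists>x y. P x y \<and> x \<in> A \<and> y \<notin> A}"
  have finF: "finite F" using F X(1) by (meson finite_Pow_iff finite_subset)
  then have finD: "finite D" by (simp add: D_def)
  have "\<forall>A\<in>D. \<exists>e. P (fst e) (snd e) \<and> fst e \<in> A \<and> snd e \<notin> A"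
    by (auto simp: D_def)
  then obtain h where h: "\<forall>A\<in>D. P (fst (h A)) (snd (h A)) \<and> fst (h A) \<in> A \<and> snd (h A) \<notin> A"
    by metis
  define E where "E = h ` D"
  \<comment> \<open>One representative per used pair: \<open>h\<close> undoes
    \<open>\<alpha>\<close> on \<open>E\<close>, so different edges get different sets.\<close>
  define \<alpha> where "\<alpha> = inv_into D h"
  have finE: "finite E" using finD by (simp add: E_def)
  have \<alpha>D: "\<alpha> e \<in> D" and h\<alpha>: "h (\<alpha> e) = e" if "e \<in> E" for e
    using that by (auto simp: E_def \<alpha>_def inv_into_into f_inv_into_f)
  have \<alpha>F: "\<alpha> e \<in> F" if "e \<in> E" for e using \<alpha>D[OF that] by (simp add: D_def)
  have \<alpha>: "P x y" "x \<in> \<alpha> (x, y)" "y \<notin> \<alpha> (x, y)" if "(x, y) \<in> E" for x y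
    using h \<alpha>D[OF that] h\<alpha>[OF that] by force+
  have inj: "inj_on \<alpha> E" using h\<alpha> by (metis inj_onI)
  \<comment> \<open>As \<open>\<alpha>\<close> is injective on \<open>E\<close>, these edges are no
    more numerous than the sets showing the rare pattern. Both thinnings below take their in-degree
    bound from here.\<close>
  have few_swaps: "card {e \<in> E. x \<in> \<alpha> e \<and> y \<notin> \<alpha> e} \<le> t" if "P x y" for x y
  proof -
    have "card {e \<in> E. x \<in> \<alpha> e \<and> y \<notin> \<alpha> e} = card (\<alpha> ` {e \<in> E. x \<in> \<alpha> e \<and> y \<notin> \<alpha> e})"
      using inj by (intro card_image[symmetric]) (auto intro: inj_on_subset)
    also have "\<dots> \<le> card {A \<in> F. x \<in> A \<and> y \<notin> A}"
      using \<alpha>F finF by (intro card_mono) auto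
    finally show ?thesis using that by (simp add: P_def)
  qed

  have "card D = (\<Sum>e\<in>E. card {A \<in> D. h A = e})"
    using sum.image_gen[OF finD, of "\<lambda>_. 1 :: nat" h] by (simp add: E_def)
  also have "\<dots> \<le> (\<Sum>e\<in>E. t)"
  proof (rule sum_mono)
    fix e assume "e \<in> E"
    then obtain A where A: "A \<in> D" "e = h A" by (auto simp: E_def)
    have "card {A \<in> D. h A = e} \<le> card {A \<in> F. fst e \<in> A \<and> snd e \<notin> A}"
      using h finF by (intro card_mono) (auto simp: D_def)
    also have "\<dots> \<le> t" using h A by (auto simp: P_def)
    finally show "card {A \<in> D. h A = e} \<le> t" .
  qed
  finally have cD: "card D \<le> t * card E" by (simp add: mult.commute)

  define N where "N x = {y. (x, y) \<in> E}" for x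
  have N: "N x \<subseteq> X" for x using \<alpha>(1) by (auto simp: N_def P_def)
  then have finN: "finite (N x)" for x using X(1) finite_subset by blast
  have "E = (SIGMA x:X. N x)" using \<alpha>(1) by (auto simp: N_def P_def)
  then have cE: "card E = (\<Sum>x\<in>X. card (N x))" using X finN by simp
  \<comment> \<open>The arcs go from \<open>y'\<close> to \<open>y\<close> when
    \<open>y \<notin> \<alpha> (x, y')\<close>. Such sets contain \<open>x\<close> and miss
    \<open>y\<close>, a rare pattern, so in-degrees are at most \<open>t\<close>.\<close>
  have "\<exists>M\<subseteq>N x. (\<forall>y'\<in>M. \<forall>y\<in>M. y' \<noteq> y \<longrightarrow> \<not> y \<notin> \<alpha> (x, y')) \<and>
      card (N x) \<le> (2 * t + 1) * card M" for x
  proof (rule exists_large_independent_set[OF finN], intro ballI)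
    fix y assume "y \<in> N x"
    then have "P x y" using \<alpha>(1) by (simp add: N_def)
    have "card {y' \<in> N x. y \<notin> \<alpha> (x, y')} = card (Pair x ` {y' \<in> N x. y \<notin> \<alpha> (x, y')})"
      by (intro card_image[symmetric]) (auto simp: inj_on_def)
    also have "\<dots> \<le> card {e \<in> E. x \<in> \<alpha> e \<and> y \<notin> \<alpha> e}"
      using finE \<alpha>(2) by (intro card_mono) (auto simp: N_def)
    also have "\<dots> \<le> t" using few_swaps[OF \<open>P x y\<close>] .
    finally show "card {y' \<in> N x. y \<notin> \<alpha> (x, y')} \<le> t" .
  qed
  then obtain M where M: "\<And>x. M x \<subseteq> N x"
      "\<And>x y y'. y \<in> M x \<Longrightarrow> y' \<in> M x \<Longrightarrow> y' \<noteq> y \<Longrightarrow> y \<in> \<alpha> (x, y')"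
      "\<And>x. card (N x) \<le> (2 * t + 1) * card (M x)"
    by metis

  have "card {x \<in> X. S \<subseteq> M x} \<le> (2 * (s * t) + 1) * r + s" if S: "S \<subseteq> X" "card S = s" for S
  proof (rule ccontr)
    assume large: "\<not> ?thesis"
    \<comment> \<open>Removing \<open>S\<close> makes the future \<open>W\<close> disjoint from
      \<open>S\<close>; it costs at most \<open>s\<close> vertices, the summand \<open>s\<close> in
      the bound.\<close>
    define V where "V = {x \<in> X. S \<subseteq> M x} - S"
    have finS: "finite S" using S(1) X(1) finite_subset by blast
    have finV: "finite V" using X(1) by (simp add: V_def)
    have cV: "(2 * (s * t) + 1) * r \<le> card V"
      using large S(2) diff_card_le_card_Diff[OF finS, of "{x \<in> X. S \<subseteq> M x}"] by (simp add: V_def)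
    have VE: "(x, y) \<in> E" if "x \<in> V" "y \<in> S" for x y
      using that M(1) by (auto simp: V_def N_def)
    \<comment> \<open>Each \<open>\<alpha> (x, y)\<close> containing \<open>x'\<close> misses
      \<open>y\<close>, and \<open>(x', y)\<close> is itself a rare pair because
      \<open>x' \<in> V\<close>. Hence each \<open>y \<in> S\<close> adds at most \<open>t\<close>
      to the in-degree of \<open>x'\<close>, in total \<open>s * t\<close>.\<close>
    have "\<exists>W\<subseteq>V. (\<forall>x\<in>W. \<forall>x'\<in>W. x \<noteq> x' \<longrightarrow> \<not> (\<exists>y\<in>S. x' \<in> \<alpha> (x, y))) \<and>
        card V \<le> (2 * (s * t) + 1) * card W"
    proof (rule exists_large_independent_set[OF finV], intro ballI)
      fix x' assume x': "x' \<in> V"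
      have "card {x \<in> V. \<exists>y\<in>S. x' \<in> \<alpha> (x, y)} = card (\<Union>y\<in>S. {x \<in> V. x' \<in> \<alpha> (x, y)})"
        by (rule arg_cong[where f = card]) auto
      also have "\<dots> \<le> (\<Sum>y\<in>S. card {x \<in> V. x' \<in> \<alpha> (x, y)})"
        using finS by (rule card_UN_le)
      also have "\<dots> \<le> (\<Sum>y\<in>S. t)"
      proof (rule sum_mono)
        fix y assume y: "y \<in> S"
        have "card {x \<in> V. x' \<in> \<alpha> (x, y)} = card ((\<lambda>x. (x, y)) ` {x \<in> V. x' \<in> \<alpha> (x, y)})"
          by (intro card_image[symmetric]) (auto simp: inj_on_def)
        also have "\<dots> \<le> card {e \<in> E. x' \<in> \<alpha> e \<and> y \<notin> \<alpha> e}"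
          using finE \<alpha>(3) VE y by (intro card_mono) auto
        also have "\<dots> \<le> t" using few_swaps \<alpha>(1) VE x' y by blast
        finally show "card {x \<in> V. x' \<in> \<alpha> (x, y)} \<le> t" .
      qed
      finally show "card {x \<in> V. \<exists>y\<in>S. x' \<in> \<alpha> (x, y)} \<le> s * t" using S(2) by simp
    qed
    then obtain W' where W': "W' \<subseteq> V" "card V \<le> (2 * (s * t) + 1) * card W'"
        "\<And>x x' y. x \<in> W' \<Longrightarrow> x' \<in> W' \<Longrightarrow> x \<noteq> x' \<Longrightarrow> y \<in> S \<Longrightarrow> x' \<notin> \<alpha> (x, y)"
      by metis
    have "(2 * (s * t) + 1) * r \<le> (2 * (s * t) + 1) * card W'" using cV W'(2) by (rule order_trans)
    then have "r \<le> card W'" by (simp only: mult_le_cancel1)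
    then obtain W where W: "W \<subseteq> W'" "card W = r"
      by (meson obtain_subset_with_card_n)
    \<comment> \<open>The witness is \<open>\<alpha> (x, y)\<close>: the second thinning controls
      its trace on \<open>W\<close>, the first, through \<open>S \<subseteq> M x\<close>, its trace
      on \<open>S\<close>.\<close>
    have "\<exists>A\<in>F. A \<inter> W = {x} \<and> A \<inter> S = S - {y}" if "x \<in> W" "y \<in> S" for x y
    proof (intro bexI conjI)
      have xV: "x \<in> V" using that W W' by blast
      show "\<alpha> (x, y) \<in> F" using \<alpha>F VE xV that by blast
      show "\<alpha> (x, y) \<inter> W = {x}" using \<alpha>(2) VE xV W W'(3) that by blast
      show "\<alpha> (x, y) \<inter> S = S - {y}"
        using \<alpha>(3)[OF VE[OF xV that(2)]] M(2)[of _ x y] xV that(2)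
        by (auto simp: V_def dest: subsetD)
    qed
    moreover have "W \<subseteq> X" "W \<inter> S = {}" using W W'(1) by (auto simp: V_def)
    ultimately show False using no_product S W(2) by blast
  qed
  then have kst: "(\<Sum>x\<in>X. real (card (M x)))
      \<le> (1 + real s + real s ^ s * real ((2 * (s * t) + 1) * r + s)) * ?B"
    using M(1) N by (intro kovari_sos_turan[OF X s]) blast+

  have "card D \<le> t * (2 * t + 1) * (\<Sum>x\<in>X. card (M x))"
  proof -
    have "card E \<le> (2 * t + 1) * (\<Sum>x\<in>X. card (M x))"
      unfolding cE sum_distrib_left by (intro sum_mono M(3))
    then have "t * card E \<le> t * ((2 * t + 1) * (\<Sum>x\<in>X. card (M x)))"
      by (rule mult_le_mono2)
    then show ?thesis using cD by (simp only: mult.assoc)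
  qed
  then have "real (card D) \<le> real (t * (2 * t + 1)) * (\<Sum>x\<in>X. real (card (M x)))"
    by (simp only: flip: of_nat_sum of_nat_mult of_nat_le_iff)
  also have "\<dots> \<le> real (t * (2 * t + 1)) *
      ((1 + real s + real s ^ s * real ((2 * (s * t) + 1) * r + s)) * ?B)"
    by (intro mult_left_mono kst) simp
  finally have D_le: "real (card D) \<le> real (t * (2 * t + 1)) *
      ((1 + real s + real s ^ s * real ((2 * (s * t) + 1) * r + s)) * ?B)" .

  have "card (F - D) \<le> Suc (card X)"
  proof (rule card_le_Suc_if_no_pair_shattered[OF X(1)])
    show "F - D \<subseteq> Pow X" using F by blast
    show "\<forall>x\<in>X. \<forall>y\<in>X. x \<noteq> y \<longrightarrow> (\<exists>p q. \<forall>A\<in>F - D. \<not> ((x \<in> A) = p \<and> (y \<in> A) = q))"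
    proof (intro ballI impI)
      fix x y assume xy: "x \<in> X" "y \<in> X" "x \<noteq> y"
      \<comment> \<open>One case for each of the four patterns. A rare one may occur in
        \<open>F\<close>, but every set showing it lies in \<open>D\<close>.\<close>
      then consider "\<forall>A\<in>F. \<not> (x \<notin> A \<and> y \<notin> A)" | "\<forall>A\<in>F. \<not> (x \<in> A \<and> y \<in> A)"
        | "P x y" | "P y x"
        using pairs[rule_format, OF xy] xy unfolding P_def by auto
      then show "\<exists>p q. \<forall>A\<in>F - D. \<not> ((x \<in> A) = p \<and> (y \<in> A) = q)"
      proof cases
        case 1 then show ?thesis by (intro exI[of _ False]) auto
      next
        case 2 then show ?thesis by (intro exI[of _ True]) auto
      next
        case 3 then show ?thesis by (intro exI[of _ True] exI[of _ False]) (auto simp: D_def)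
      next
        case 4 then show ?thesis by (intro exI[of _ False] exI[of _ True]) (auto simp: D_def)
      qed
    qed
  qed
  moreover have "card X \<ge> 1" using X by (simp add: Suc_le_eq card_gt_0_iff)
  ultimately have "real (card (F - D)) \<le> 2 * real (card X) powr 1" by simp
  \<comment> \<open>The exponent \<open>2 - 1 / real s\<close> is at least 1 because
    \<open>s \<ge> 1\<close>.\<close>
  also have "\<dots> \<le> 2 * ?B"
    using \<open>card X \<ge> 1\<close> s by (intro mult_left_mono powr_mono) auto
  finally have "real (card (F - D)) \<le> 2 * ?B" .
  moreover have "card F = card (F - D) + card D"
    using finF finD by (metis (no_types, lifting) D_def card_Diff_subset card_mono le_add_diff_inverse2 mem_Collect_eq subsetI)
  ultimately show ?thesis using D_le by (simp add: algebra_simps)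
qed

section \<open>Configurations from injections, and columns as sets\<close>

text \<open>A submatrix lists its rows and columns in increasing order, whereas
  \<open>\<rho>\<close> and \<open>\<kappa>\<close> may choose them in any order; the two
  permutations in the definition absorb the difference.\<close>

lemma configuration_ofI:
  assumes \<rho>: "inj_on \<rho> {..<dim_row F}" "\<rho> ` {..<dim_row F} \<subseteq> {..<dim_row A}"
    and \<kappa>: "inj_on \<kappa> {..<dim_col F}" "\<kappa> ` {..<dim_col F} \<subseteq> {..<dim_col A}"
    and entries: "\<And>i j. i < dim_row F \<Longrightarrow> j < dim_col F \<Longrightarrow> A $$ (\<rho> i, \<kappa> j) = F $$ (i, j)"
  shows "F \<prec> A"
proof -
  \<comment> \<open>The permutation sorts \<open>f\<close>: \<open>p i\<close> is the preimage of
    the \<open>i\<close>-th smallest value. Outside \<open>{..<n}\<close> it is the identity, as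
    \<open>permutes\<close> demands.\<close>
  have pick_perm: "\<exists>p. p permutes {..<n} \<and> (\<forall>i<n. f (p i) = pick (f ` {..<n}) i)"
    if "inj_on f {..<n}" for f :: "nat \<Rightarrow> nat" and n
  proof -
    let ?I = "f ` {..<n}"
    have cI: "card ?I = n" using that by (simp add: card_image)
    define p where "p i = (if i < n then inv_into {..<n} f (pick ?I i) else i)" for i
    have f_p: "p i < n \<and> f (p i) = pick ?I i" if "i < n" for i
    proof -
      have "pick ?I i \<in> ?I" using that cI by (intro pick_in_set_le) simp
      then show ?thesis
        using that inv_into_into[of "pick ?I i" f "{..<n}"] by (simp add: p_def f_inv_into_f)
    qed
    have "inj_on p {..<n}"
    proof (rule linorder_inj_onI')
      fix i j assume ij: "i \<in> {..<n}" "j \<in> {..<n}" "i < j"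
      then have "pick ?I i < pick ?I j" using cI by (intro pick_mono_le) auto
      then show "p i \<noteq> p j" using f_p ij by (metis lessThan_iff less_irrefl)
    qed
    moreover have "p ` {..<n} \<subseteq> {..<n}" using f_p by auto
    ultimately have "bij_betw p {..<n} {..<n}"
      by (simp add: bij_betw_def endo_inj_surj)
    then have "p permutes {..<n}"
      by (intro bij_imp_permutes) (auto simp: p_def)
    then show ?thesis using f_p by blast
  qed
  obtain p where p: "p permutes {..<dim_row F}"
      "\<forall>i<dim_row F. \<rho> (p i) = pick (\<rho> ` {..<dim_row F}) i"
    using pick_perm[OF \<rho>(1)] by blast
  obtain q where q: "q permutes {..<dim_col F}"
      "\<forall>j<dim_col F. \<kappa> (q j) = pick (\<kappa> ` {..<dim_col F}) j"
    using pick_perm[OF \<kappa>(1)] by blast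
  have "{i. i < dim_row A \<and> i \<in> \<rho> ` {..<dim_row F}} = \<rho> ` {..<dim_row F}"
    and "{j. j < dim_col A \<and> j \<in> \<kappa> ` {..<dim_col F}} = \<kappa> ` {..<dim_col F}"
    using \<rho>(2) \<kappa>(2) by auto
  then have card_eq: "card {i. i < dim_row A \<and> i \<in> \<rho> ` {..<dim_row F}} = dim_row F"
    "card {j. j < dim_col A \<and> j \<in> \<kappa> ` {..<dim_col F}} = dim_col F"
    using \<rho>(1) \<kappa>(1) by (simp_all add: card_image)
  have "submatrix A (\<rho> ` {..<dim_row F}) (\<kappa> ` {..<dim_col F})
      = mat (dim_row F) (dim_col F) (\<lambda>(i, j). F $$ (p i, q j))"
  proof (rule eq_matI)
    fix i j assume "i < dim_row (mat (dim_row F) (dim_col F) (\<lambda>(i, j). F $$ (p i, q j)))"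
      and "j < dim_col (mat (dim_row F) (dim_col F) (\<lambda>(i, j). F $$ (p i, q j)))"
    then have ij: "i < dim_row F" "j < dim_col F" by simp_all
    then have "p i < dim_row F" "q j < dim_col F"
      using permutes_in_image[OF p(1)] permutes_in_image[OF q(1)] by auto
    then show "submatrix A (\<rho> ` {..<dim_row F}) (\<kappa> ` {..<dim_col F}) $$ (i, j)
        = mat (dim_row F) (dim_col F) (\<lambda>(i, j). F $$ (p i, q j)) $$ (i, j)"
      using ij p(2) q(2) entries[of "p i" "q j"] by (simp add: submatrix_index card_eq)
  qed (simp_all add: dim_submatrix card_eq)
  then show ?thesis
    unfolding configuration_of_def row_col_permutation_def using \<rho>(2) \<kappa>(2) p(1) q(1) by blast
qed

lemma entry_zero_one:
  assumes "zero_one_mat A" "i < dim_row A" "j < dim_col A"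
  shows "A $$ (i, j) = 0 \<or> A $$ (i, j) = 1"
  using assms elements_matI[of A "dim_row A" "dim_col A" i j] by (auto simp: zero_one_mat_def)

definition column_support :: "nat mat \<Rightarrow> nat \<Rightarrow> nat set" where
  "column_support A j = {i. i < dim_row A \<and> A $$ (i, j) = 1}"

text \<open>A column with entries 0 and 1 is determined by its support, so passing from columns to
  sets preserves the count.\<close>

lemma inj_on_column_support:
  assumes "simple_mat A"
  shows "inj_on (column_support A) {..<dim_col A}"
proof (rule inj_onI)
  fix j k assume jk: "j \<in> {..<dim_col A}" "k \<in> {..<dim_col A}"
    and eq: "column_support A j = column_support A k"
  have "col A j = col A k"
  proof (rule eq_vecI)
    fix i assume "i < dim_vec (col A k)"
    then have i: "i < dim_row A" by simp
    have "A $$ (i, j) = 1 \<longleftrightarrow> A $$ (i, k) = 1" using eq i by (auto simp: column_support_def)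
    then have "A $$ (i, j) = A $$ (i, k)"
      using entry_zero_one[of A i j] entry_zero_one[of A i k] assms i jk
      by (auto simp: simple_mat_def)
    then show "col A j $ i = col A k $ i" using i jk by simp
  qed simp
  then show "j = k"
    using assms jk nth_eq_iff_index_eq[of "cols A" j k] by (simp add: simple_mat_def)
qed

section \<open>Realising \<open>Q3 t\<close> in a matrix\<close>

lemma dim_Q3: "dim_row (Q3 t) = 2" "dim_col (Q3 t) = 2 * t + 2"
  by (simp_all add: Q3_def mat_of_cols_list_def)

lemma Q3_index:
  assumes "j < 2 * t + 2"
  shows "Q3 t $$ (0, j) = (if j \<in> {1..t} \<or> j = 2 * t + 1 then 1 else 0)"
    and "Q3 t $$ (1, j) = (if j \<in> {t + 1..2 * t + 1} then 1 else 0)"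
proof -
  let ?cs = "[[0, 0]] @ replicate t [1, 0] @ replicate t [0, 1] @ [[1, 1 :: nat]]"
  have index: "Q3 t $$ (i, j) = ?cs ! j ! i" if "i < 2" for i
    using assms that by (simp add: Q3_def mat_of_cols_list_def)
  have col: "?cs ! j = (if j = 0 then [0, 0] else if j \<le> t then [1, 0]
      else if j \<le> 2 * t then [0, 1] else [1, 1])"
    using assms by (cases j) (auto simp: nth_append)
  show "Q3 t $$ (0, j) = (if j \<in> {1..t} \<or> j = 2 * t + 1 then 1 else 0)"
    and "Q3 t $$ (1, j) = (if j \<in> {t + 1..2 * t + 1} then 1 else 0)"
    using assms index[of 0] index[of 1] unfolding col by auto
qed

lemma Q3_configurationI:
  assumes xy: "x < dim_row A" "y < dim_row A" "x \<noteq> y" and A: "zero_one_mat A"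
    and a: "a < dim_col A" "x \<notin> column_support A a" "y \<notin> column_support A a"
    and b: "b < dim_col A" "x \<in> column_support A b" "y \<in> column_support A b"
    and g: "inj_on g {..<t}" "\<forall>i<t. g i < dim_col A \<and> x \<in> column_support A (g i) \<and> y \<notin> column_support A (g i)"
    and h: "inj_on h {..<t}" "\<forall>i<t. h i < dim_col A \<and> y \<in> column_support A (h i) \<and> x \<notin> column_support A (h i)"
  shows "Q3 t \<prec> A"
proof (rule configuration_ofI)
  let ?\<rho> = "\<lambda>i :: nat. if i = 0 then x else y"
  \<comment> \<open>This follows the four blocks of \<open>Q3 t\<close>, which start at columns
    \<open>0\<close>, \<open>1\<close>, \<open>t + 1\<close> and \<open>2 * t + 1\<close>; the
    offsets restart the enumerations \<open>g\<close> and \<open>h\<close> at 0.\<close>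
  let ?\<kappa> = "\<lambda>j. if j = 0 then a else if j \<le> t then g (j - 1)
      else if j \<le> 2 * t then h (j - (t + 1)) else b"
  show "inj_on ?\<rho> {..<dim_row (Q3 t)}" using xy by (auto simp: inj_on_def dim_Q3)
  show "?\<rho> ` {..<dim_row (Q3 t)} \<subseteq> {..<dim_row A}" using xy by auto
  show "?\<kappa> ` {..<dim_col (Q3 t)} \<subseteq> {..<dim_col A}"
  proof (rule image_subsetI)
    fix j assume "j \<in> {..<dim_col (Q3 t)}"
    then have "j < 2 * t + 2" by (simp add: dim_Q3)
    then show "?\<kappa> j \<in> {..<dim_col A}"
      using a(1) b(1) g(2)[rule_format, of "j - 1"] h(2)[rule_format, of "j - (t + 1)"] by simp
  qed
  have z: "A $$ (i, j) = (if i \<in> column_support A j then 1 else 0)"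
    if "i < dim_row A" "j < dim_col A" for i j
    using entry_zero_one[OF A that] that by (auto simp: column_support_def)
  show entries: "A $$ (?\<rho> i, ?\<kappa> j) = Q3 t $$ (i, j)"
    if "i < dim_row (Q3 t)" "j < dim_col (Q3 t)" for i j
  proof -
    have i: "i = 0 \<or> i = 1" and j: "j < 2 * t + 2" using that by (auto simp: dim_Q3)
    consider "j = 0" | "1 \<le> j" "j \<le> t" | "t < j" "j \<le> 2 * t" | "j = 2 * t + 1" using j by linarith
    then show ?thesis
    proof cases
      case 1
      then show ?thesis
        using i z[OF xy(1) a(1)] z[OF xy(2) a(1)] a(2,3) Q3_index[OF j] by (elim disjE) simp_all
    next
      case 2
      then have "j - 1 < t" by simp
      then have "g (j - 1) < dim_col A" "x \<in> column_support A (g (j - 1))"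
        "y \<notin> column_support A (g (j - 1))" using g(2) by blast+
      then show ?thesis
        using 2 i z[of x "g (j - 1)"] z[of y "g (j - 1)"] xy(1,2) Q3_index[OF j]
        by (elim disjE) simp_all
    next
      case 3
      then have "j - (t + 1) < t" by simp
      then have "h (j - (t + 1)) < dim_col A" "y \<in> column_support A (h (j - (t + 1)))"
        "x \<notin> column_support A (h (j - (t + 1)))" using h(2) by blast+
      then show ?thesis
        using 3 i z[of x "h (j - (t + 1))"] z[of y "h (j - (t + 1))"] xy(1,2) Q3_index[OF j]
        by (elim disjE) simp_all
    next
      case 4
      then show ?thesis
        using i z[OF xy(1) b(1)] z[OF xy(2) b(1)] b(2,3) Q3_index[OF j] by (elim disjE) simp_all
    qed
  qed
  show "inj_on ?\<kappa> {..<dim_col (Q3 t)}"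
  proof (rule linorder_inj_onI')
    fix j k assume "j \<in> {..<dim_col (Q3 t)}" "k \<in> {..<dim_col (Q3 t)}" and jk: "j < k"
    then have b: "j < 2 * t + 2" "k < 2 * t + 2" by (simp_all add: dim_Q3)
    show "?\<kappa> j \<noteq> ?\<kappa> k"
    proof
      assume eq: "?\<kappa> j = ?\<kappa> k"
      then have e: "Q3 t $$ (0, j) = Q3 t $$ (0, k)" "Q3 t $$ (1, j) = Q3 t $$ (1, k)"
        using entries[of 0 j] entries[of 0 k] entries[of 1 j] entries[of 1 k] b
        by (simp_all add: dim_Q3)
      then have "j \<in> {1..t} \<or> j = 2 * t + 1 \<longleftrightarrow> k \<in> {1..t} \<or> k = 2 * t + 1"
        "j \<in> {t + 1..2 * t + 1} \<longleftrightarrow> k \<in> {t + 1..2 * t + 1}"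
        unfolding Q3_index[OF b(1)] Q3_index[OF b(2)] by (metis one_neq_zero)+
      \<comment> \<open>Equal columns of \<open>A\<close> force equal columns of
        \<open>Q3 t\<close>, hence the same block; as \<open>j < k\<close>, it is one of the two
        blocks of length \<open>t\<close>.\<close>
      then consider "1 \<le> j" "k \<le> t" | "t < j" "k \<le> 2 * t"
        using jk b unfolding atLeastAtMost_iff by linarith
      then show False
      proof cases
        case 1
        then have "g (j - 1) = g (k - 1)" using eq jk by simp
        then have "j - 1 = k - 1" using 1 jk by (auto dest: inj_onD[OF g(1)])
        then show False using 1 jk by linarith
      next
        case 2
        then have "h (j - (t + 1)) = h (k - (t + 1))" using eq jk by simp
        then have "j - (t + 1) = k - (t + 1)" using 2 jk by (auto dest: inj_onD[OF h(1)])
        then show False using 2 jk by linarith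
      qed
    qed
  qed
qed

section \<open>Realising the product of an identity and a complemented identity\<close>

abbreviation identity_times_complement :: "nat \<Rightarrow> nat \<Rightarrow> nat mat" where
  "identity_times_complement r s \<equiv> mat_product (1\<^sub>m r) (complement_mat (1\<^sub>m s))"

lemma dim_identity_times_complement:
  "dim_row (identity_times_complement r s) = r + s" "dim_col (identity_times_complement r s) = r * s"
  by (simp_all add: mat_product_def complement_mat_def)

lemma identity_times_complement_index:
  assumes "i < r + s" "j < r * s"
  shows "identity_times_complement r s $$ (i, j) =
    (if i < r then if i = j div s then 1 else 0 else if i - r = j mod s then 0 else 1)"
proof -
  have "j div s < r" using assms(2) by (simp add: less_mult_imp_div_less)
  moreover have "j mod s < s" using assms(2) by (cases "s = 0") auto
  ultimately show ?thesis using assms by (auto simp: mat_product_def complement_mat_def)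
qed

text \<open>Column \<open>j\<close> of the product stands for the pair
  \<open>(j div s, j mod s)\<close>: its only one in the upper part is in row
  \<open>j div s\<close>, its only zero in the lower part in row \<open>j mod s\<close>. After
  enumerating \<open>W\<close> and \<open>S\<close>, these are the prescribed traces.\<close>

lemma identity_times_complement_configurationI:
  assumes A: "zero_one_mat A"
    and W: "W \<subseteq> {..<dim_row A}" "card W = r" and S: "S \<subseteq> {..<dim_row A}" "card S = s"
    and disj: "W \<inter> S = {}"
    and c: "\<forall>x\<in>W. \<forall>y\<in>S. \<exists>j<dim_col A. column_support A j \<inter> W = {x} \<and> column_support A j \<inter> S = S - {y}"
  shows "identity_times_complement r s \<prec> A"
proof -
  have "finite W" "finite S" using W S finite_subset by blast+
  then obtain u v where u: "bij_betw u {..<r} W" and v: "bij_betw v {..<s} S"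
    using ex_bij_betw_nat_finite W(2) S(2) by (metis atLeast0LessThan)
  have uW: "u i \<in> W" if "i < r" for i using u that by (auto simp: bij_betw_def)
  have vS: "v i \<in> S" if "i < s" for i using v that by (auto simp: bij_betw_def)
  have u_eq: "u i = u j \<longleftrightarrow> i = j" if "i < r" "j < r" for i j
    using u that by (auto simp: bij_betw_def inj_on_def)
  have v_eq: "v i = v j \<longleftrightarrow> i = j" if "i < s" "j < s" for i j
    using v that by (auto simp: bij_betw_def inj_on_def)
  obtain k where k: "\<And>x y. x \<in> W \<Longrightarrow> y \<in> S \<Longrightarrow> k x y < dim_col A \<and>
      column_support A (k x y) \<inter> W = {x} \<and> column_support A (k x y) \<inter> S = S - {y}"
    using c by metis
  let ?\<rho> = "\<lambda>i. if i < r then u i else v (i - r)"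
  let ?\<kappa> = "\<lambda>j. k (u (j div s)) (v (j mod s))"
  have dm: "j div s < r" "j mod s < s" if "j < r * s" for j
    using that by (simp add: less_mult_imp_div_less, cases s) simp_all
  have entry: "A $$ (i, j) = (if i \<in> column_support A j then 1 else 0)"
    if "i < dim_row A" "j < dim_col A" for i j
    using entry_zero_one[OF A that] that by (auto simp: column_support_def)
  show ?thesis
  proof (rule configuration_ofI, unfold dim_identity_times_complement)
    show "inj_on ?\<rho> {..<r + s}"
    proof (rule inj_onI)
      fix i j assume ij: "i \<in> {..<r + s}" "j \<in> {..<r + s}" and eq: "?\<rho> i = ?\<rho> j"
      have ij_less: "i < r + s" "j < r + s" using ij by simp_all
      have *: "u a \<noteq> v b" if "a < r" "b < s" for a b
        using uW[OF that(1)] vS[OF that(2)] disj by auto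
      show "i = j"
      proof (cases "i < r"; cases "j < r")
        assume "i < r" "j < r"
        then show ?thesis using eq u_eq by simp
      next
        assume "i < r" "\<not> j < r"
        moreover from this have "j - r < s" using ij_less by linarith
        ultimately show ?thesis using eq *[of i "j - r"] by simp
      next
        assume "\<not> i < r" "j < r"
        moreover from this have "i - r < s" using ij_less by linarith
        ultimately show ?thesis using eq *[of j "i - r"] by simp
      next
        assume "\<not> i < r" "\<not> j < r"
        moreover from this have "i - r < s" "j - r < s" using ij_less by linarith+
        ultimately show ?thesis using eq v_eq[of "i - r" "j - r"] by simp
      qed
    qed
    show "?\<rho> ` {..<r + s} \<subseteq> {..<dim_row A}"
    proof (rule image_subsetI)
      fix i assume "i \<in> {..<r + s}"
      then have "i < r \<or> i - r < s" unfolding lessThan_iff by linarith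
      then show "?\<rho> i \<in> {..<dim_row A}" using uW[of i] vS[of "i - r"] W(1) S(1) by auto
    qed
    have kk: "?\<kappa> j < dim_col A" "column_support A (?\<kappa> j) \<inter> W = {u (j div s)}"
        "column_support A (?\<kappa> j) \<inter> S = S - {v (j mod s)}" if "j < r * s" for j
      using k[OF uW[OF dm(1)[OF that]] vS[OF dm(2)[OF that]]] by simp_all
    show "?\<kappa> ` {..<r * s} \<subseteq> {..<dim_col A}"
      by (rule image_subsetI) (simp add: kk(1))
    show entries: "A $$ (?\<rho> i, ?\<kappa> j) = identity_times_complement r s $$ (i, j)"
      if ij: "i < r + s" "j < r * s" for i j
    proof -
      note kk = kk[OF ij(2)] and dm = dm[OF ij(2)]
      show ?thesis
      proof (cases "i < r")
        case True
        then have "u i \<in> column_support A (?\<kappa> j) \<longleftrightarrow> i = j div s"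
          using kk(2) uW[of i] u_eq[of i "j div s"] dm(1) by auto
        then show ?thesis
          using True entry[of "u i" "?\<kappa> j"] kk(1) uW[of i] W(1) ij
          by (simp add: identity_times_complement_index subset_iff)
      next
        case False
        then have l: "i - r < s" using ij by simp
        then have "v (i - r) \<in> column_support A (?\<kappa> j) \<longleftrightarrow> i - r \<noteq> j mod s"
          using kk(3) vS[OF l] v_eq[OF l dm(2)] by auto
        then show ?thesis
          using False entry[of "v (i - r)" "?\<kappa> j"] kk(1) vS[OF l] S(1) ij
          by (simp add: identity_times_complement_index subset_iff)
      qed
    qed
    show "inj_on ?\<kappa> {..<r * s}"
    proof (rule inj_onI)
      fix j j' assume "j \<in> {..<r * s}" "j' \<in> {..<r * s}" and eq: "?\<kappa> j = ?\<kappa> j'"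
      then have jj: "j < r * s" "j' < r * s" by auto
      \<comment> \<open>The traces on \<open>W\<close> and \<open>S\<close> recover the pair, and
        thereby \<open>j\<close>; the removed point can be read off because it belongs to
        \<open>S\<close>.\<close>
      have "{u (j div s)} = {u (j' div s)}" "S - {v (j mod s)} = S - {v (j' mod s)}"
        using kk(2,3)[OF jj(1)] kk(2,3)[OF jj(2)] unfolding eq by (simp_all only:)
      then have "u (j div s) = u (j' div s)" "v (j mod s) = v (j' mod s)"
        using vS[OF dm(2)[OF jj(1)]] by blast+
      then have "j div s = j' div s" "j mod s = j' mod s"
        using u_eq v_eq dm[OF jj(1)] dm[OF jj(2)] by blast+
      then show "j = j'" by (metis div_mult_mod_eq)
    qed
  qed
qed

section \<open>From avoiding matrices to set families\<close>

theorem theorem4p10: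
  fixes r s t :: nat
  assumes "t \<ge> 2" and "s \<ge> 1" and "s \<le> r"
  shows "(\<lambda>m. real (forb m {Q3 t, mat_product (1\<^sub>m r) (complement_mat (1\<^sub>m s))}))
           \<in> O(\<lambda>m. real m powr (2 - 1 / real s))"
proof -
  let ?\<F> = "{Q3 t, identity_times_complement r s}"
  define K where "K = 2 + real (t * (2 * t + 1)) *
    (1 + real s + real s ^ s * real ((2 * (s * t) + 1) * r + s))"
  have "real (forb m ?\<F>) \<le> K * real m powr (2 - 1 / real s)" if m: "m \<ge> 1" for m
  proof -
    \<comment> \<open>The product has \<open>r * s > 0\<close> columns, so \<open>Max\<close> is
      taken over a nonempty set and an extremal matrix \<open>A\<close> exists.\<close>
    have "avoiding_mats m ?\<F> \<noteq> {}"
      using assms by (intro avoiding_mats_nonempty) (auto simp: dim_Q3 dim_identity_times_complement)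
    then have "forb m ?\<F> \<in> dim_col ` avoiding_mats m ?\<F>"
      unfolding forb_def by (intro Max_in finite_dim_col_avoiding) auto
    then obtain A where A: "A \<in> avoiding_mats m ?\<F>" "forb m ?\<F> = dim_col A" by blast
    then have dim: "dim_row A = m" and simple: "simple_mat A" and zo: "zero_one_mat A"
      and noQ: "\<not> Q3 t \<prec> A" and noI: "\<not> identity_times_complement r s \<prec> A"
      by (auto simp: avoiding_mats_def simple_mat_def)
    define F where "F = column_support A ` {..<dim_col A}"
    note inj = inj_on_column_support[OF simple]
    \<comment> \<open>This turns a lower bound on the number of sets into an enumeration of
      \<open>t\<close> distinct columns, the form that \<open>Q3_configurationI\<close>
      takes.\<close>
    have many: "\<exists>g. inj_on g {..<t} \<and> (\<forall>i<t. g i < dim_col A \<and> Q (column_support A (g i)))"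
      if "\<not> card {B \<in> F. Q B} < t" for Q
    proof -
      let ?J = "{j. j < dim_col A \<and> Q (column_support A j)}"
      have "{B \<in> F. Q B} = column_support A ` ?J" by (auto simp: F_def)
      then have "card {..<t} \<le> card ?J"
        using that card_image_le[of ?J "column_support A"] by simp
      then obtain g where "inj_on g {..<t}" "g ` {..<t} \<subseteq> ?J"
        using card_le_inj[of "{..<t}" ?J] by auto
      then show ?thesis by blast
    qed
    have "real (card F) \<le> K * real (card {..<m}) powr (2 - 1 / real s)"
      unfolding K_def
    proof (rule real_card_family_le)
      show "finite {..<m}" "{..<m} \<noteq> {}" "s \<ge> 1" "F \<subseteq> Pow {..<m}"
        using m assms dim by (auto simp: F_def column_support_def lessThan_empty_iff)
      show "\<forall>x\<in>{..<m}. \<forall>y\<in>{..<m}. x \<noteq> y \<longrightarrow>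
        (\<forall>B\<in>F. x \<in> B \<or> y \<in> B) \<or> (\<forall>B\<in>F. \<not> (x \<in> B \<and> y \<in> B)) \<or>
        card {B \<in> F. x \<in> B \<and> y \<notin> B} < t \<or> card {B \<in> F. y \<in> B \<and> x \<notin> B} < t"
      proof (intro ballI impI, rule ccontr)
        fix x y assume xy: "x \<in> {..<m}" "y \<in> {..<m}" "x \<noteq> y"
          and neg: "\<not> ((\<forall>B\<in>F. x \<in> B \<or> y \<in> B) \<or> (\<forall>B\<in>F. \<not> (x \<in> B \<and> y \<in> B)) \<or>
            card {B \<in> F. x \<in> B \<and> y \<notin> B} < t \<or> card {B \<in> F. y \<in> B \<and> x \<notin> B} < t)"
        from neg obtain a b where
          "a < dim_col A" "x \<notin> column_support A a" "y \<notin> column_support A a"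
          "b < dim_col A" "x \<in> column_support A b" "y \<in> column_support A b"
          by (auto simp: F_def)
        moreover obtain g where "inj_on g {..<t}"
          "\<forall>i<t. g i < dim_col A \<and> x \<in> column_support A (g i) \<and> y \<notin> column_support A (g i)"
          using many[of "\<lambda>B. x \<in> B \<and> y \<notin> B"] neg by blast
        moreover obtain h where "inj_on h {..<t}"
          "\<forall>i<t. h i < dim_col A \<and> y \<in> column_support A (h i) \<and> x \<notin> column_support A (h i)"
          using many[of "\<lambda>B. y \<in> B \<and> x \<notin> B"] neg by blast
        ultimately show False
          using noQ Q3_configurationI[of x A y a b g t h] xy dim zo by auto
      qed
      show "\<not> (\<exists>W\<subseteq>{..<m}. \<exists>S\<subseteq>{..<m}. W \<inter> S = {} \<and> card W = r \<and> card S = s \<and>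
        (\<forall>x\<in>W. \<forall>y\<in>S. \<exists>B\<in>F. B \<inter> W = {x} \<and> B \<inter> S = S - {y}))"
      proof
        assume "\<exists>W\<subseteq>{..<m}. \<exists>S\<subseteq>{..<m}. W \<inter> S = {} \<and> card W = r \<and> card S = s \<and>
          (\<forall>x\<in>W. \<forall>y\<in>S. \<exists>B\<in>F. B \<inter> W = {x} \<and> B \<inter> S = S - {y})"
        then obtain W S where "W \<subseteq> {..<m}" "S \<subseteq> {..<m}" "W \<inter> S = {}" "card W = r" "card S = s"
          and c: "\<And>x y. x \<in> W \<Longrightarrow> y \<in> S \<Longrightarrow> \<exists>B\<in>F. B \<inter> W = {x} \<and> B \<inter> S = S - {y}"
          by blast
        moreover have "\<exists>j<dim_col A. column_support A j \<inter> W = {x} \<and>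
            column_support A j \<inter> S = S - {y}" if "x \<in> W" "y \<in> S" for x y
          using c[OF that] unfolding F_def by blast
        ultimately show False
          using noI identity_times_complement_configurationI[OF zo, of W r S s] dim by blast
      qed
    qed
    moreover have "card F = dim_col A" unfolding F_def by (simp add: card_image inj)
    ultimately show ?thesis using A(2) by simp
  qed
  then show ?thesis
    by (intro bigoI[of _ K] eventually_mono[OF eventually_ge_at_top[of 1]]) auto
qed

end
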